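(* Let $k,n\in\mathbb{N}$ with $k<n$, and let $P\subseteq[0,1]^n$ be a $(k+1)$-transitive integer-empty polytope. Then the following statements are equivalent: (A) $P$ intersects all of the $(n-k)$-dimensional faces of the hypercube $[0,1]^n$; (B) $\mathrm{SA}^k(P)\neq\emptyset$; (C) $\mathrm{LS}^k(P)\neq\emptyset$; (D) $\mathrm{LS}_0^k(P)\neq\emptyset$.
   Context: Notation: $[n]=\{1,\dots,n\}$; $\mathcal{S}_n$ is the group of all permutations of $[n]$. A polytope $P\subseteq[0,1]^n$ is integer-empty if $P\cap\{0,1\}^n=\emptyset$. Symmetry. For $\pi\in\mathcal{S}_n$ and $x\in\mathbb{R}^n$, $\pi x:=(x_{\pi^{-1}(1)},\dots,x_{\pi^{-1}(n)})$. Let $G(P):=\{\pi\in\mathcal{S}_n:\pi x\in P\text{ for all }x\in P\}$ (a group). $P$ is $G$-invariant for a subgroup $G\le\mathcal{S}_n$ if $G\le G(P)$. For $m\in[n]$, $G\le\mathcal{S}_n$ is $m$-transitive if for every two $m$-tuples $t^1,t^2$ of elements of $[n]$, each with pairwise distinct entries, there is $\pi\in G$ with $\pi(t^1_j)=t^2_j$ for all $j\in[m]$. $P$ is $m$-transitive if it is $G$-invariant for some $m$-transitive $G$. Lovász–Schrijver operators. For a polytope $P\subseteq[0,1]^n$ let $K(P):=\{(\lambda,\lambda x)^\top:\lambda\ge0,\ x\in P\}\subseteq\mathbb{R}^{n+1}$, with coordinates indexed by $\{0,1,\dots,n\}$ and canonical vectors $e_0,\dots,e_n$. Then $\mathrm{LS}_0(P)$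 is the set of all $x\in\mathbb{R}^n$ for which there is $Y\in\mathbb{R}^{(n+1)\times(n+1)}$ with $Ye_i\in K(P)$ and $Y(e_0-e_i)\in K(P)$ for all $i\in[n]$, and $Ye_0=Y^\top e_0=\mathrm{diag}(Y)=(1,x)^\top$. $\mathrm{LS}(P)$ is defined in the same way with the additional requirement that $Y$ be symmetric. $\mathrm{LS}_0^k$ and $\mathrm{LS}^k$ denote $k$ iterated applications of $\mathrm{LS}_0$ and $\mathrm{LS}$, respectively. Sherali–Adams. Let $P=\{x\in\mathbb{R}^n:a_i^\top x\ge b_i,\ i\in[m]\}\subseteq[0,1]^n$, where the description explicitly contains the inequalities $\mathbf{0}\le x\le\mathbf{1}$. Vectors $y\in\mathbb{R}^{\binom{n}{\le k+1}}$ (where $\binom{n}{\le r}:=\sum_{j=0}^r\binom nj$) have coordinates $y_I$ indexed by subsets $I\subseteq[n]$ with $|I|\le k+1$; $y_{\{j\}}$ is written $y_j$. $\mathrm{M}^k(P)$ is the set of $y\in\mathbb{R}^{\binom{n}{\le k+1}}$ with $y_\emptyset=1$ satisfying, for every $i\in[m]$, every $S\subseteq[n]$ with $|S|=k$ and every partition $S=J_0\sqcup J_1$ into two disjoint (possibly empty) sets, the linear inequality obtained from $$\prod_{l\in J_1}x_l\prod_{j\in J_0}(1-x_j)\,(a_i^\top x-b_i)\ge0$$ by expanding, replacing each $x_l^2$ by $x_l$, and then replacing each monomial $\prod_{l\in I}x_l$ by $y_I$. Finally $\mathrm{SA}^k(P):=\{x\in\mathbb{R}^n:\exists y\in\mathrm{M}^k(P),\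 y_i=x_i\ \forall i\in[n]\}$. *)

theory Defs
  imports "HOL-Analysis.Analysis" "HOL-Library.Poly_Mapping" "HOL-Algebra.Bij"
begin

text \<open>
  The index set \<open>[n]\<close> is a finite type \<open>'n\<close>, with \<open>n = CARD('n)\<close>, and the
  hypercube \<open>[0,1]\<^sup>n\<close> is \<^term>\<open>cbox 0 1 :: (real^'n) set\<close>.
\<close>

definition integer_empty :: "(real^'n) set \<Rightarrow> bool" where
  "integer_empty P \<longleftrightarrow> P \<inter> {x. \<forall>i. x $ i \<in> {0, 1}} = {}"

definition perm_act :: "('n \<Rightarrow> 'n) \<Rightarrow> real^'n \<Rightarrow> real^'n" where
  "perm_act \<pi> x = (\<chi> i. x $ (inv_into UNIV \<pi> i))"

definition sym_of :: "(real^'n) set \<Rightarrow> ('n \<Rightarrow> 'n) set" where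
  "sym_of P = {\<pi>. \<pi> permutes UNIV \<and> (\<forall>x\<in>P. perm_act \<pi> x \<in> P)}"

definition invariant_under :: "('n \<Rightarrow> 'n) set \<Rightarrow> (real^'n) set \<Rightarrow> bool" where
  "invariant_under G P \<longleftrightarrow> subgroup G (BijGroup (UNIV :: 'n set)) \<and> G \<subseteq> sym_of P"

definition transitive_perms :: "nat \<Rightarrow> ('n \<Rightarrow> 'n) set \<Rightarrow> bool" where
  "transitive_perms m G \<longleftrightarrow>
     (\<forall>s t. length s = m \<and> distinct s \<and> length t = m \<and> distinct t
        \<longrightarrow> (\<exists>\<pi>\<in>G. map \<pi> s = t))"

definition transitive_polytope :: "nat \<Rightarrow> (real^'n) set \<Rightarrow> bool" where
  "transitive_polytope m P \<longleftrightarrow> (\<exists>G. invariant_under G P \<and> transitive_perms m G)"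

text \<open>
  Coordinates \<open>{0,1,\<dots>,n}\<close> are indexed by \<open>'n option\<close>, with \<^term>\<open>None\<close> in the role
  of \<open>0\<close>; \<open>homog l x\<close> is the vector \<open>(l, x)\<close> and \<open>unit_vec i\<close> is \<open>e\<^sub>i\<close>.
\<close>

definition homog :: "real \<Rightarrow> real^'n \<Rightarrow> real^('n option)" where
  "homog l x = (\<chi> i. case i of None \<Rightarrow> l | Some j \<Rightarrow> x $ j)"

abbreviation unit_vec :: "'n::finite option \<Rightarrow> real^('n option)" where
  "unit_vec i \<equiv> axis i 1"

definition cone_K :: "(real^'n) set \<Rightarrow> (real^('n option)) set" where
  "cone_K P = {homog l (l *\<^sub>R x) | l x. l \<ge> 0 \<and> x \<in> P}"

definition LS_matrix :: "(real^'n) set \<Rightarrow> real^'n \<Rightarrow> real^('n option)^('n option) \<Rightarrow> bool" where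
  "LS_matrix P x Y \<longleftrightarrow>
     (\<forall>i. Y *v unit_vec (Some i) \<in> cone_K P \<and>
          Y *v (unit_vec None - unit_vec (Some i)) \<in> cone_K P) \<and>
     Y *v unit_vec None = homog 1 x \<and>
     transpose Y *v unit_vec None = homog 1 x \<and>
     (\<chi> i. Y $ i $ i) = homog 1 x"

definition LS0 :: "(real^'n) set \<Rightarrow> (real^'n) set" where
  "LS0 P = {x. \<exists>Y. LS_matrix P x Y}"

definition LS :: "(real^'n) set \<Rightarrow> (real^'n) set" where
  "LS P = {x. \<exists>Y. LS_matrix P x Y \<and> transpose Y = Y}"

definition box_description ::
  "nat \<Rightarrow> (nat \<Rightarrow> real^'n) \<Rightarrow> (nat \<Rightarrow> real) \<Rightarrow> (real^'n) set \<Rightarrow> bool" where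
  "box_description m a b P \<longleftrightarrow>
     P = {x. \<forall>i\<in>{1..m}. a i \<bullet> x \<ge> b i} \<and>
     (\<forall>j. \<exists>i\<in>{1..m}. a i = axis j 1 \<and> b i = 0) \<and>
     (\<forall>j. \<exists>i\<in>{1..m}. a i = - axis j 1 \<and> b i = -1)"

text \<open>
  Polynomials over the reals in the variables \<open>x\<^sub>j\<close>: a monomial is its exponent map
  \<open>'n \<Rightarrow>\<^sub>0 nat\<close>, a polynomial maps monomials to coefficients.
\<close>

type_synonym 'n mpoly = "('n \<Rightarrow>\<^sub>0 nat) \<Rightarrow>\<^sub>0 real"

definition pvar :: "'n \<Rightarrow> 'n mpoly" where
  "pvar j = Poly_Mapping.single (Poly_Mapping.single j 1) 1"

definition pconst :: "real \<Rightarrow> 'n mpoly" where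
  "pconst c = Poly_Mapping.single 0 c"

text \<open>
  Replacing \<open>x\<^sub>l\<^sup>2\<close> by \<open>x\<^sub>l\<close> turns a monomial with exponent map \<open>t\<close> into the product of
  the \<open>x\<^sub>l\<close> over the support of \<open>t\<close>, which in turn is replaced by \<open>y (keys t)\<close>.
\<close>

definition linearize :: "('n set \<Rightarrow> real) \<Rightarrow> 'n mpoly \<Rightarrow> real" where
  "linearize y p = (\<Sum>t\<in>Poly_Mapping.keys p. Poly_Mapping.lookup p t * y (Poly_Mapping.keys t))"

definition SA_poly :: "real^'n \<Rightarrow> real \<Rightarrow> 'n set \<Rightarrow> 'n set \<Rightarrow> 'n mpoly" where
  "SA_poly c d J0 J1 =
     (\<Prod>l\<in>J1. pvar l) * (\<Prod>j\<in>J0. 1 - pvar j) *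
     ((\<Sum>j\<in>UNIV. pconst (c $ j) * pvar j) - pconst d)"

definition SA_lift ::
  "nat \<Rightarrow> nat \<Rightarrow> (nat \<Rightarrow> real^'n) \<Rightarrow> (nat \<Rightarrow> real) \<Rightarrow> ('n set \<Rightarrow> real) set" where
  "SA_lift k m a b =
     {y. y \<in> {I. card I \<le> k + 1} \<rightarrow>\<^sub>E UNIV \<and> y {} = 1 \<and>
         (\<forall>i\<in>{1..m}. \<forall>S J0 J1. card S = k \<and> J0 \<union> J1 = S \<and> J0 \<inter> J1 = {}
            \<longrightarrow> linearize y (SA_poly (a i) (b i) J0 J1) \<ge> 0)}"

text \<open>
  The relaxation is a function of the chosen linear description of the polytope.
\<close>

definition SA ::
  "nat \<Rightarrow> nat \<Rightarrow> (nat \<Rightarrow> real^'n) \<Rightarrow> (nat \<Rightarrow> real) \<Rightarrow> (real^'n) set" where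
  "SA k m a b = {x. \<exists>y\<in>SA_lift k m a b. \<forall>i. y {i} = x $ i}"

end

theory Submission
  imports Defs
begin

text \<open>
  The statements are linked by (A) \<open>\<Longrightarrow>\<close> (B) \<open>\<Longrightarrow>\<close> (C) \<open>\<Longrightarrow>\<close> (D) \<open>\<Longrightarrow>\<close> (A); symmetry enters only in
  the first and the last step. A face of the cube is given by disjoint sets \<open>I\<close> and \<open>J\<close> of
  coordinates fixed to 1 and to 0, and it has dimension \<open>n - k\<close> iff \<open>card I + card J = k\<close>
  (\<open>intersects_cube_faces_iff\<close>).

  (A) \<open>\<Longrightarrow>\<close> (B). In each face with \<open>card I + card J = k\<close> take the point of \<open>P\<close> of least norm. By
  uniqueness it is carried along by the symmetries of \<open>P\<close>, so \<open>(k + 1)\<close>-transitivity makes it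
  constant outside \<open>I \<union> J\<close>, with a value \<open>\<alpha>\<^sub>i\<close> depending only on \<open>i = card I\<close>; and
  \<open>0 < \<alpha>\<^sub>i < 1\<close> because \<open>P\<close> has no integer points (\<open>ex_level_point\<close>). One then looks for a
  symmetric family of weights of the events ``1 on \<open>I\<close>, 0 on \<open>J\<close>'' on \<open>k + 1\<close> coordinates, under
  which a free coordinate is 1 with probability \<open>\<alpha>\<^sub>i\<close> when \<open>k\<close> coordinates are fixed, \<open>i\<close> of
  them to 1. Weights \<open>v\<^sub>i\<close> with \<open>v\<^sub>i\<^sub>+\<^sub>1 = \<alpha>\<^sub>i / (1 - \<alpha>\<^sub>i) v\<^sub>i\<close> do this, and their
  moments lie in \<open>M\<^sup>k(P)\<close> (\<open>SA_nonempty_of_level_points\<close>).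

  (B) \<open>\<Longrightarrow>\<close> (C). In fact \<open>SA\<^sup>k(P) \<subseteq> LS\<^sup>k(P)\<close> for every \<open>P\<close> in the cube. A vector in \<open>M\<^sup>k(P)\<close> assigns
  pseudo-probabilities to the events on at most \<open>k + 1\<close> coordinates; conditional second moments
  are symmetric certificates for conditional expectations, and the columns of such a certificate
  are conditional expectations with one more coordinate fixed (\<open>cond_point_mem_LS_funpow\<close>).

  (C) \<open>\<Longrightarrow>\<close> (D) drops the symmetry of the certificates.

  (D) \<open>\<Longrightarrow>\<close> (A). With \<open>P\<close>, all its iterates under \<open>LS\<^sub>0\<close> have no integer points, so a point of \<open>LS\<^sub>0\<^sup>k(P)\<close> has a
  fractional coordinate, which may be rounded either way at the cost of one iteration. After \<open>k\<close>
  rounds \<open>P\<close> contains a point with any prescribed numbers of coordinates rounded to 1 and to 0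
  (\<open>LS0_funpow_rounding\<close>), and transitivity moves it to the desired face.
\<close>

section \<open>Linearization of polynomials\<close>

lemma linearize_eq_sum:
  assumes "finite A" "Poly_Mapping.keys p \<subseteq> A"
  shows "linearize y p = (\<Sum>t\<in>A. Poly_Mapping.lookup p t * y (Poly_Mapping.keys t))"
  unfolding linearize_def
  by (rule sum.mono_neutral_left) (use assms in \<open>auto simp: in_keys_iff\<close>)

lemma linearize_zero [simp]: "linearize y 0 = 0"
  by (simp add: linearize_def)

lemma linearize_add: "linearize y (p + q) = linearize y p + linearize y q"
proof -
  let ?A = "Poly_Mapping.keys p \<union> Poly_Mapping.keys q"
  have "linearize y (p + q) = (\<Sum>t\<in>?A. Poly_Mapping.lookup (p + q) t * y (Poly_Mapping.keys t))"
    by (rule linearize_eq_sum) (simp_all add: Poly_Mapping.keys_add)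
  also have "\<dots> = linearize y p + linearize y q"
    by (subst (1 2) linearize_eq_sum[where A = ?A])
       (simp_all add: lookup_add distrib_right sum.distrib)
  finally show ?thesis .
qed

lemma linearize_uminus: "linearize y (- p) = - linearize y p"
  using linearize_add[of y p "- p"] by simp

lemma linearize_diff: "linearize y (p - q) = linearize y p - linearize y q"
  using linearize_add[of y p "- q"] by (simp add: linearize_uminus)

lemma linearize_sum: "linearize y (\<Sum>i\<in>A. f i) = (\<Sum>i\<in>A. linearize y (f i))"
  by (induction A rule: infinite_finite_induct) (simp_all add: linearize_add)

lemma linearize_single: "linearize y (Poly_Mapping.single t c) = c * y (Poly_Mapping.keys t)"
  by (simp add: linearize_def)

lemma poly_mapping_eq_sum_single:
  "p = (\<Sum>t\<in>Poly_Mapping.keys p. Poly_Mapping.single t (Poly_Mapping.lookup p t))"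
  by (rule poly_mapping_eqI)
     (auto simp: lookup_sum lookup_single when_def in_keys_iff)

text \<open>
  Multiplying by a monomial with support \<open>S\<close> amounts to precomposing \<open>y\<close> with \<open>(\<union>) S\<close>. Since
  \<open>(\<union>) S\<close> is idempotent, the rule \<open>x\<^sub>j\<^sup>2 = x\<^sub>j\<close> becomes automatic after linearization.
\<close>

lemma linearize_single_mult:
  "linearize y (Poly_Mapping.single s c * p) =
     c * linearize (\<lambda>I. y (Poly_Mapping.keys s \<union> I)) p"
proof -
  have keys_plus: "Poly_Mapping.keys (s + t) = Poly_Mapping.keys s \<union> Poly_Mapping.keys t" for t
    by (auto simp: in_keys_iff lookup_add)
  have "Poly_Mapping.single s c * p =
      (\<Sum>t\<in>Poly_Mapping.keys p. Poly_Mapping.single (s + t) (c * Poly_Mapping.lookup p t))"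
    by (subst poly_mapping_eq_sum_single[of p]) (simp add: sum_distrib_left mult_single)
  then show ?thesis
    by (simp add: linearize_sum linearize_single keys_plus)
       (simp add: linearize_def sum_distrib_left mult.assoc)
qed

lemma linearize_pconst_mult: "linearize y (pconst c * p) = c * linearize y p"
  by (simp add: pconst_def linearize_single_mult)

lemma linearize_pvar_mult: "linearize y (pvar j * p) = linearize (\<lambda>I. y (insert j I)) p"
  by (simp add: pvar_def linearize_single_mult)

section \<open>Pseudo-probabilities\<close>

text \<open>
  If \<open>y I\<close> were the probability that a random 0/1 vector is 1 on \<open>I\<close>, this would be the
  probability that the vector is 1 on \<open>I\<close> and 0 on \<open>J\<close>. For arbitrary \<open>y\<close> the values may be
  negative, but the additivity laws of probabilities persist.
\<close>

definition pseudo_prob :: "('n::finite set \<Rightarrow> real) \<Rightarrow> 'n set \<Rightarrow> 'n set \<Rightarrow> real" where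
  "pseudo_prob y I J = linearize y ((\<Prod>l\<in>I. pvar l) * (\<Prod>j\<in>J. 1 - pvar j))"

lemma linearize_pvar_prod_mult:
  fixes I :: "'n::finite set"
  shows "linearize y ((\<Prod>l\<in>I. pvar l) * p) = linearize (\<lambda>K. y (I \<union> K)) p"
proof -
  have "finite I" by simp
  then show ?thesis
    by (induction I arbitrary: y)
       (simp_all add: linearize_pvar_mult mult.assoc)
qed

lemma linearize_pvar_absorb:
  fixes I :: "'n::finite set"
  shows "linearize y ((\<Prod>l\<in>I. pvar l) * (pvar j * p)) = linearize y ((\<Prod>l\<in>insert j I. pvar l) * p)"
  unfolding linearize_pvar_prod_mult linearize_pvar_mult by simp

lemma pseudo_prob_empty: "pseudo_prob y I {} = y (I :: 'n::finite set)"
  using linearize_pvar_prod_mult[of y I 1]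
  by (simp add: pseudo_prob_def linearize_single flip: single_one)

text \<open>
  This is the expansion of the factor \<open>1 - x\<^sub>j\<close>. It reduces every pseudo-probability to values
  of \<open>y\<close>, by induction on \<open>J\<close>.
\<close>

lemma pseudo_prob_insert_right:
  assumes "j \<notin> J"
  shows "pseudo_prob y I (insert j J) = pseudo_prob y I J - pseudo_prob y (insert j I) J"
proof -
  have "(\<Prod>l\<in>I. pvar l) * (\<Prod>l\<in>insert j J. 1 - pvar l) =
      (\<Prod>l\<in>I. pvar l) * (\<Prod>l\<in>J. 1 - pvar l) -
      (\<Prod>l\<in>I. pvar l) * (pvar j * (\<Prod>l\<in>J. 1 - pvar l :: 'a mpoly))"
    using assms by (simp add: algebra_simps)
  then show ?thesis
    by (simp only: pseudo_prob_def linearize_diff linearize_pvar_absorb)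
qed

text \<open>
  The factor \<open>x\<^sub>j (1 - x\<^sub>j)\<close> vanishes after replacing \<open>x\<^sub>j\<^sup>2\<close> by \<open>x\<^sub>j\<close>.
\<close>

lemma pseudo_prob_overlap: "I \<inter> J \<noteq> {} \<Longrightarrow> pseudo_prob y I J = 0"
proof -
  assume "I \<inter> J \<noteq> {}"
  then obtain j where j: "j \<in> I" "j \<in> J" by auto
  then have "pseudo_prob y I (insert j (J - {j})) = 0"
    by (subst pseudo_prob_insert_right) (simp_all add: insert_absorb)
  with j show ?thesis by (simp add: insert_absorb)
qed

text \<open>
  The law of total probability for coordinate \<open>j\<close>. It holds for every \<open>j\<close>, also for
  \<open>j \<in> I \<union> J\<close>, so that later arguments need no case distinction.
\<close>

lemma pseudo_prob_split: "pseudo_prob y I J = pseudo_prob y (insert j I) J + pseudo_prob y I (insert j J)"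
proof (cases "j \<in> J")
  case True
  then show ?thesis by (simp add: pseudo_prob_overlap insert_absorb)
qed (simp add: pseudo_prob_insert_right)

text \<open>
  The linearized Sherali--Adams inequality says that the vector of weights of the events
  ``1 on \<open>J1\<close> and at \<open>j\<close>, 0 on \<open>J0\<close>'' satisfies the constraint scaled by the weight of
  ``1 on \<open>J1\<close>, 0 on \<open>J0\<close>''.
\<close>

lemma linearize_SA_poly:
  "linearize y (SA_poly c d J0 J1) =
     (\<Sum>j\<in>UNIV. c $ j * pseudo_prob y (insert j J1) J0) - d * pseudo_prob y J1 J0"
proof -
  let ?p = "\<Prod>l\<in>J1. pvar l" and ?q = "\<Prod>l\<in>J0. 1 - pvar l :: 'a mpoly"
  have "SA_poly c d J0 J1 =
      (\<Sum>j\<in>UNIV. pconst (c $ j) * (?p * (pvar j * ?q))) - pconst d * (?p * ?q)"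
    by (simp add: SA_poly_def algebra_simps sum_distrib_left)
  then show ?thesis
    by (simp only: linearize_diff linearize_sum linearize_pconst_mult linearize_pvar_absorb pseudo_prob_def)
qed

section \<open>Sherali--Adams is contained in Lovasz--Schrijver\<close>

text \<open>
  Membership in the cone is used for vectors of the form \<open>l (1, x)\<close> where \<open>x\<close> is a conditional
  expectation, which is meaningful only for \<open>l > 0\<close>; for \<open>l = 0\<close> any point of \<open>Q\<close> serves.
\<close>

lemma cone_K_homogI:
  assumes "l \<ge> 0" "l > 0 \<Longrightarrow> x \<in> Q" "Q \<noteq> {}"
    and "l > 0 \<Longrightarrow> v = l *\<^sub>R homog 1 x" "l = 0 \<Longrightarrow> v = 0"
  shows "v \<in> cone_K Q"
proof (cases "l = 0")
  case True
  obtain q where "q \<in> Q" using assms(3) by auto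
  moreover have "v = homog 0 (0 *\<^sub>R q)"
    using True assms by (simp add: homog_def vec_eq_iff split: option.split)
  ultimately show ?thesis unfolding cone_K_def by blast
next
  case False
  then have "v = homog l (l *\<^sub>R x)"
    using assms by (simp add: homog_def vec_eq_iff split: option.split)
  then show ?thesis using False assms unfolding cone_K_def by fastforce
qed

text \<open>
  The definition imposes the inequalities for events on exactly \<open>k\<close> coordinates. Those for
  events on fewer coordinates are sums of them: split the event along an unused coordinate,
  which exists as long as fewer than \<open>k \<le> n\<close> coordinates are used.
\<close>

lemma SA_lift_ineq:
  fixes a :: "nat \<Rightarrow> real^'n"
  assumes y: "y \<in> SA_lift k m a b" and i: "i \<in> {1..m}" and k: "k \<le> CARD('n)"
    and IJ: "card (I \<union> J) \<le> k"
  shows "b i * pseudo_prob y I J \<le> (\<Sum>j\<in>UNIV. a i $ j * pseudo_prob y (insert j I) J)"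
  using IJ
proof (induction "k - card (I \<union> J)" arbitrary: I J)
  case 0
  show ?case
  proof (cases "I \<inter> J = {}")
    case True
    then have "linearize y (SA_poly (a i) (b i) J I) \<ge> 0"
      using y i 0 unfolding SA_lift_def by (auto simp: Un_commute Int_commute)
    then show ?thesis by (simp add: linearize_SA_poly)
  next
    case False
    then have "pseudo_prob y I J = 0" "\<And>j. pseudo_prob y (insert j I) J = 0"
      by (auto intro!: pseudo_prob_overlap)
    then show ?thesis by simp
  qed
next
  case (Suc r)
  then have less: "card (I \<union> J) < k" by simp
  then have "I \<union> J \<noteq> UNIV" using k by auto
  then obtain e where e: "e \<notin> I \<union> J" by auto
  have *: "r = k - card (insert e I \<union> J)" "r = k - card (I \<union> insert e J)"
    "card (insert e I \<union> J) \<le> k" "card (I \<union> insert e J) \<le> k"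
    using Suc.hyps(2) less e by simp_all
  have "b i * pseudo_prob y I J = b i * pseudo_prob y (insert e I) J + b i * pseudo_prob y I (insert e J)"
    by (subst pseudo_prob_split[of y I J e]) (simp add: distrib_left)
  also have "\<dots> \<le> (\<Sum>j\<in>UNIV. a i $ j * pseudo_prob y (insert j (insert e I)) J)
      + (\<Sum>j\<in>UNIV. a i $ j * pseudo_prob y (insert j I) (insert e J))"
    using Suc.hyps(1)[of "insert e I" J] Suc.hyps(1)[of I "insert e J"] * by (intro add_mono) auto
  also have "\<dots> = (\<Sum>j\<in>UNIV. a i $ j * pseudo_prob y (insert j I) J)"
    by (simp add: sum.distrib[symmetric] distrib_left[symmetric] insert_commute[of _ e]
        pseudo_prob_split[of y _ J e, symmetric])
  finally show ?case .
qed

text \<open>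
  The inequalities \<open>0 \<le> x\<^sub>j \<le> 1\<close> are part of the description. Multiplied with the indicator of
  an event on at most \<open>k\<close> coordinates they say that both parts into which coordinate \<open>j\<close> splits
  the event have nonnegative weight. Hence so does the event itself, and every satisfiable event
  on \<open>k + 1\<close> coordinates is such a part.
\<close>

lemma SA_lift_pseudo_prob_nonneg:
  fixes a :: "nat \<Rightarrow> real^'n"
  assumes y: "y \<in> SA_lift k m a b" and P: "box_description m a b P" and k: "k < CARD('n)"
    and IJ: "card (I \<union> J) \<le> k + 1"
  shows "0 \<le> pseudo_prob y I J"
proof -
  have ax: "(\<Sum>l\<in>UNIV. axis j 1 $ l * f l) = f j" for f :: "'n \<Rightarrow> real" and j
    by (subst sum.mono_neutral_right[of _ "{j}"]) (auto simp: axis_def)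
  have low: "0 \<le> pseudo_prob y (insert j I) J"
    and upp: "pseudo_prob y (insert j I) J \<le> pseudo_prob y I J"
    if "card (I \<union> J) \<le> k" for I J j
  proof -
    obtain i where "i \<in> {1..m}" "a i = axis j 1" "b i = 0"
      using P unfolding box_description_def by blast
    then show "0 \<le> pseudo_prob y (insert j I) J"
      using SA_lift_ineq[OF y, of i I J] k that by (simp add: ax)
    obtain i where "i \<in> {1..m}" "a i = - axis j 1" "b i = -1"
      using P unfolding box_description_def by blast
    then show "pseudo_prob y (insert j I) J \<le> pseudo_prob y I J"
      using SA_lift_ineq[OF y, of i I J] k that by (simp add: ax sum_negf)
  qed
  show ?thesis
  proof (cases "card (I \<union> J) \<le> k")
    case True
    then show ?thesis using order_trans[OF low upp] by blast
  next
    case False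
    then have "I \<union> J \<noteq> {}" by (metis card.empty le0)
    then obtain e where e: "e \<in> I \<union> J" by blast
    then have c: "card (I \<union> J - {e}) \<le> k" using IJ by simp
    consider "e \<in> I" "e \<in> J" | "e \<in> I" "e \<notin> J" | "e \<in> J" "e \<notin> I" using e by blast
    then show ?thesis
    proof cases
      case 1 then show ?thesis using pseudo_prob_overlap[of I J y] by fastforce
    next
      case 2
      then have "(I - {e}) \<union> J = I \<union> J - {e}" by blast
      then show ?thesis using low[of "I - {e}" J e] c 2 by (simp add: insert_absorb)
    next
      case 3
      then have "I \<union> (J - {e}) = I \<union> J - {e}" by blast
      then show ?thesis using upp[of I "J - {e}" e] c 3 pseudo_prob_split[of y I "J - {e}" e]
        by (simp add: insert_absorb)
    qed
  qed
qed

text \<open>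
  The conditional expectation given the event ``1 on \<open>I\<close>, 0 on \<open>J\<close>'', and the matrix of
  conditional second moments, with coordinate \<open>None\<close> standing for the constant 1 and hence
  contributing no element to the event.
\<close>

definition cond_point :: "('n::finite set \<Rightarrow> real) \<Rightarrow> 'n set \<Rightarrow> 'n set \<Rightarrow> real^'n" where
  "cond_point y I J = (\<chi> j. pseudo_prob y (insert j I) J / pseudo_prob y I J)"

definition moment_matrix :: "('n::finite set \<Rightarrow> real) \<Rightarrow> 'n set \<Rightarrow> 'n set \<Rightarrow> real^('n option)^('n option)" where
  "moment_matrix y I J = (\<chi> r c. pseudo_prob y (set_option r \<union> set_option c \<union> I) J / pseudo_prob y I J)"

text \<open>
  The matrix of conditional second moments is a certificate for the conditional expectation: its
  column \<open>e\<close> is a multiple of the conditional expectation given that coordinate \<open>e\<close> is 1 as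
  well, and the difference to column 0 is the analogue for coordinate \<open>e\<close> being 0. Fixing one
  more coordinate costs one application of \<open>LS\<close>. The hypothesis is \<open>\<le> k\<close> rather than \<open>= k\<close>
  because a coordinate \<open>e\<close> of \<open>I \<union> J\<close> does not enlarge the event; this form of the induction
  avoids showing that \<open>LS\<close> preserves convexity.
\<close>

lemma cond_point_mem_LS_funpow:
  fixes a :: "nat \<Rightarrow> real^'n"
  assumes y: "y \<in> SA_lift k m a b" and P: "box_description m a b P" and k: "k < CARD('n)"
    and IJ: "card (I \<union> J) + t \<le> k" and pos: "pseudo_prob y I J > 0"
  shows "cond_point y I J \<in> (LS ^^ t) P"
  using IJ pos
proof (induction t arbitrary: I J)
  case 0
  have "b i \<le> a i \<bullet> cond_point y I J" if "i \<in> {1..m}" for i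
  proof -
    have "a i \<bullet> cond_point y I J = (\<Sum>j\<in>UNIV. a i $ j * pseudo_prob y (insert j I) J) / pseudo_prob y I J"
      by (simp add: inner_vec_def cond_point_def sum_divide_distrib)
    then show ?thesis
      using SA_lift_ineq[OF y that, of I J] k 0 by (simp add: le_divide_eq)
  qed
  then show ?case using P unfolding box_description_def by simp
next
  case (Suc t)
  let ?Q = "(LS ^^ t) P" and ?Y = "moment_matrix y I J" and ?z = "pseudo_prob y I J"
  have ne: "?Q \<noteq> {}" using Suc.IH[of I J] Suc.prems by auto
  have nonneg: "0 \<le> pseudo_prob y I' J'" if "card (I' \<union> J') \<le> k + 1" for I' J'
    using SA_lift_pseudo_prob_nonneg[OF y P k that] .
  have col: "(?Y *v unit_vec c) $ r = ?Y $ r $ c" for r c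
    by (simp add: matrix_vector_mult_basis column_def)
  have card_insert: "card (insert e A) \<le> Suc (card A)" for e :: 'n and A by (simp add: card_insert_if)
  have one: "?Y *v unit_vec (Some e) \<in> cone_K ?Q" for e
  proof (rule cone_K_homogI[where l = "pseudo_prob y (insert e I) J / ?z" and x = "cond_point y (insert e I) J"])
    have c: "card (insert e I \<union> J) + t \<le> k"
      using card_insert[of e "I \<union> J"] Suc.prems by simp
    have col_e: "(?Y *v unit_vec (Some e)) $ r = pseudo_prob y (set_option r \<union> insert e I) J / ?z" for r
      unfolding col by (simp add: moment_matrix_def)
    show "pseudo_prob y (insert e I) J / ?z \<ge> 0"
      using nonneg[of "insert e I" J] c Suc.prems by simp
    show "?Q \<noteq> {}" by (rule ne)
    {
      assume "pseudo_prob y (insert e I) J / ?z > 0"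
      then have pos: "pseudo_prob y (insert e I) J > 0"
        using Suc.prems by (simp add: zero_less_divide_iff)
      then show "cond_point y (insert e I) J \<in> ?Q" using Suc.IH[OF c] by simp
      show "?Y *v unit_vec (Some e) =
          (pseudo_prob y (insert e I) J / ?z) *\<^sub>R homog 1 (cond_point y (insert e I) J)"
        unfolding vec_eq_iff col_e using pos
        by (auto simp: homog_def cond_point_def insert_commute split: option.split)
    next
      assume "pseudo_prob y (insert e I) J / ?z = 0"
      then have zero: "pseudo_prob y (insert e I) J = 0" using Suc.prems by simp
      \<comment> \<open>An event that implies an event of weight 0 has weight 0, because weights of
        events on at most \<open>k + 1\<close> coordinates are nonnegative.\<close>
      have "pseudo_prob y (insert j (insert e I)) J = 0" for j
      proof -
        have "card (insert j (insert e I \<union> J)) \<le> k + 1"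
          using card_insert[of j "insert e I \<union> J"] c by simp
        then have "0 \<le> pseudo_prob y (insert j (insert e I)) J" "0 \<le> pseudo_prob y (insert e I) (insert j J)"
          by (auto intro!: nonneg)
        then show ?thesis using zero pseudo_prob_split[of y "insert e I" J j] by simp
      qed
      then have "pseudo_prob y (insert e (insert j I)) J = 0" for j
        by (simp add: insert_commute[of e j])
      then have "pseudo_prob y (set_option r \<union> insert e I) J = 0" for r using zero by (cases r) auto
      then show "?Y *v unit_vec (Some e) = 0"
        unfolding vec_eq_iff col_e by simp
    }
  qed
  have two: "?Y *v (unit_vec None - unit_vec (Some e)) \<in> cone_K ?Q" for e
  proof (rule cone_K_homogI[where l = "pseudo_prob y I (insert e J) / ?z" and x = "cond_point y I (insert e J)"])
    have c: "card (I \<union> insert e J) + t \<le> k"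
      using card_insert[of e "I \<union> J"] Suc.prems by simp
    have diff: "pseudo_prob y I' J - pseudo_prob y (insert e I') J = pseudo_prob y I' (insert e J)" for I'
      using pseudo_prob_split[of y I' J e] by simp
    have col_e: "(?Y *v (unit_vec None - unit_vec (Some e))) $ r =
        pseudo_prob y (set_option r \<union> I) (insert e J) / ?z" for r
      using diff[of "set_option r \<union> I"]
      by (simp add: matrix_vector_mult_diff_distrib col)
         (simp add: moment_matrix_def diff_divide_distrib[symmetric])
    show "pseudo_prob y I (insert e J) / ?z \<ge> 0"
      using nonneg[of I "insert e J"] c Suc.prems by simp
    show "?Q \<noteq> {}" by (rule ne)
    {
      assume "pseudo_prob y I (insert e J) / ?z > 0"
      then have pos: "pseudo_prob y I (insert e J) > 0"
        using Suc.prems by (simp add: zero_less_divide_iff)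
      then show "cond_point y I (insert e J) \<in> ?Q" using Suc.IH[OF c] by simp
      show "?Y *v (unit_vec None - unit_vec (Some e)) =
          (pseudo_prob y I (insert e J) / ?z) *\<^sub>R homog 1 (cond_point y I (insert e J))"
        unfolding vec_eq_iff col_e using pos
        by (auto simp: homog_def cond_point_def split: option.split)
    next
      assume "pseudo_prob y I (insert e J) / ?z = 0"
      then have zero: "pseudo_prob y I (insert e J) = 0" using Suc.prems by simp
      have "pseudo_prob y (insert j I) (insert e J) = 0" for j
      proof -
        have "card (insert j (I \<union> insert e J)) \<le> k + 1"
          using card_insert[of j "I \<union> insert e J"] c by simp
        then have "0 \<le> pseudo_prob y (insert j I) (insert e J)" "0 \<le> pseudo_prob y I (insert j (insert e J))"
          by (auto intro!: nonneg simp: insert_commute)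
        then show ?thesis using zero pseudo_prob_split[of y I "insert e J" j] by simp
      qed
      then have "pseudo_prob y (set_option r \<union> I) (insert e J) = 0" for r using zero by (cases r) auto
      then show "?Y *v (unit_vec None - unit_vec (Some e)) = 0"
        unfolding vec_eq_iff col_e by simp
    }
  qed
  have "transpose ?Y = ?Y"
    by (simp add: transpose_def moment_matrix_def Un_commute)
  moreover have "?Y *v unit_vec None = homog 1 (cond_point y I J)"
    unfolding vec_eq_iff col using Suc.prems
    by (auto simp: moment_matrix_def homog_def cond_point_def split: option.split)
  moreover have "(\<chi> i. ?Y $ i $ i) = homog 1 (cond_point y I J)"
    unfolding vec_eq_iff using Suc.prems
    by (auto simp: moment_matrix_def homog_def cond_point_def split: option.split)
  ultimately have "LS_matrix ?Q (cond_point y I J) ?Y" using one two by (simp add: LS_matrix_def)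
  with \<open>transpose ?Y = ?Y\<close> show ?case by (auto simp: LS_def[of ?Q])
qed

text \<open>
  A point of \<open>SA\<close> is the expectation given the empty event.
\<close>

lemma SA_subset_LS_funpow:
  fixes a :: "nat \<Rightarrow> real^'n"
  assumes P: "box_description m a b P" and k: "k < CARD('n)"
  shows "SA k m a b \<subseteq> (LS ^^ k) P"
proof
  fix x assume "x \<in> SA k m a b"
  then obtain y where y: "y \<in> SA_lift k m a b" and x: "\<And>i. y {i} = x $ i"
    unfolding SA_def by auto
  have one: "pseudo_prob y {} {} = 1" using y by (simp add: pseudo_prob_empty SA_lift_def)
  then have "cond_point y {} {} = x"
    using x by (simp add: cond_point_def pseudo_prob_empty vec_eq_iff)
  then show "x \<in> (LS ^^ k) P"
    using cond_point_mem_LS_funpow[OF y P k, of "{}" "{}" k] one by simp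
qed

section \<open>Faces of the hypercube\<close>

definition cube_face :: "'n set \<Rightarrow> 'n set \<Rightarrow> (real^'n) set" where
  "cube_face I J = {x \<in> cbox 0 1. (\<forall>i\<in>I. x $ i = 1) \<and> (\<forall>j\<in>J. x $ j = 0)}"

text \<open>
  For disjoint \<open>I\<close> and \<open>J\<close> the affine hull of \<open>cube_face I J\<close> is \<open>cube_flat I J\<close>. A proper face has empty interior, so it is
  compared with an open box that is \<open>(0,1)\<close> in the free coordinates and contains the closed unit
  interval in the fixed ones: intersecting the flat with this box gives the relative interior
  of the face.
\<close>

definition cube_flat :: "'n set \<Rightarrow> 'n set \<Rightarrow> (real^'n) set" where
  "cube_flat I J = {x. (\<forall>i\<in>I. x $ i = 1) \<and> (\<forall>j\<in>J. x $ j = 0)}"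

definition free_box :: "'n set \<Rightarrow> (real^'n) set" where
  "free_box K = box (\<chi> i. if i \<in> K then -1 else 0) (\<chi> i. if i \<in> K then 2 else 1)"

lemma mem_unit_cube: "x \<in> cbox 0 (1 :: real^'n) \<longleftrightarrow> (\<forall>i. 0 \<le> x $ i \<and> x $ i \<le> 1)"
  by (simp add: mem_box_cart)

lemma mem_free_box:
  "x \<in> free_box K \<longleftrightarrow> (\<forall>i. (i \<in> K \<longrightarrow> -1 < x $ i \<and> x $ i < 2) \<and> (i \<notin> K \<longrightarrow> 0 < x $ i \<and> x $ i < 1))"
  by (auto simp: free_box_def mem_box_cart split: if_splits)

lemma open_free_box: "open (free_box K)"
  by (simp add: free_box_def open_box)

lemma cube_flat_Int_free_box: "cube_flat I J \<inter> free_box (I \<union> J) \<subseteq> cube_face I J"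
proof
  fix x assume "x \<in> cube_flat I J \<inter> free_box (I \<union> J)"
  then have x: "x \<in> cube_flat I J" and *: "\<And>i. i \<notin> I \<union> J \<Longrightarrow> 0 < x $ i \<and> x $ i < 1"
    by (auto simp: mem_free_box)
  have "0 \<le> x $ i \<and> x $ i \<le> 1" for i
    using x *[of i] by (cases "i \<in> I \<union> J") (auto simp: cube_flat_def)
  then show "x \<in> cube_face I J"
    using x by (simp add: cube_flat_def cube_face_def mem_unit_cube)
qed

lemma cube_face_subset_flat: "cube_face I J \<subseteq> cube_flat I J"
  by (auto simp: cube_flat_def cube_face_def)

lemma affine_cube_flat: "affine (cube_flat I J)"
proof -
  have "cube_flat I J = (\<Inter>i\<in>I. {x. axis i 1 \<bullet> x = 1}) \<inter> (\<Inter>j\<in>J. {x. axis j 1 \<bullet> x = 0})"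
    by (auto simp: cube_flat_def inner_axis')
  then show ?thesis by (auto intro!: affine_Int affine_Inter affine_hyperplane)
qed

lemma affine_hull_cube_face:
  fixes I J :: "'n::finite set"
  assumes "I \<inter> J = {}"
  shows "affine hull (cube_face I J) = cube_flat I J"
proof
  show "affine hull (cube_face I J) \<subseteq> cube_flat I J"
    by (intro hull_minimal cube_face_subset_flat affine_cube_flat)
  define c :: "real^'n" where "c = (\<chi> i. if i \<in> I then 1 else if i \<in> J then 0 else 1/2)"
  have "c \<in> cube_flat I J \<inter> free_box (I \<union> J)"
    using assms by (auto simp: c_def cube_flat_def mem_free_box)
  then have "affine hull (cube_flat I J \<inter> free_box (I \<union> J)) = cube_flat I J"
    by (metis affine_hull_affine_Int_open affine_cube_flat affine_hull_eq empty_iff open_free_box)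
  then show "cube_flat I J \<subseteq> affine hull (cube_face I J)"
    using hull_mono[OF cube_flat_Int_free_box] by metis
qed

lemma aff_dim_cube_face:
  fixes I J :: "'n::finite set"
  assumes "I \<inter> J = {}"
  shows "aff_dim (cube_face I J) = int (CARD('n) - card (I \<union> J))"
proof -
  define c :: "real^'n" where "c = (\<chi> i. if i \<in> I then 1 else 0)"
  let ?V = "{x :: real^'n. \<forall>i. i \<notin> - (I \<union> J) \<longrightarrow> x $ i = 0}"
  have flat: "x \<in> cube_flat I J \<longleftrightarrow> x - c \<in> ?V" for x
    using assms by (auto simp: c_def cube_flat_def)
  have "cube_flat I J = (+) c ` ?V"
  proof (intro Set.set_eqI iffI)
    fix x assume "x \<in> cube_flat I J"
    then have "x - c \<in> ?V" by (simp only: flat)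
    then show "x \<in> (+) c ` ?V" by (rule image_eqI[rotated]) simp
  next
    fix x assume "x \<in> (+) c ` ?V"
    then obtain v where "v \<in> ?V" "x = c + v" by blast
    then show "x \<in> cube_flat I J" by (simp only: flat add_diff_cancel_left')
  qed
  then have "aff_dim (cube_face I J) = aff_dim ?V"
    using aff_dim_affine_hull[of "cube_face I J"] affine_hull_cube_face[OF assms]
    by (simp add: aff_dim_translation_eq)
  also have "\<dots> = int (dim ?V)"
    by (rule aff_dim_subspace) (auto simp: subspace_def)
  also have "dim ?V = card (- (I \<union> J))"
    using dim_substandard_cart[of "- (I \<union> J)", where 'a = real] by (simp add: dim_vec_eq)
  finally show ?thesis by (simp add: Compl_eq_Diff_UNIV card_Diff_subset)
qed

lemma cube_face_face_of:
  fixes I J :: "'n::finite set"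
  shows "cube_face I J face_of cbox 0 1"
proof -
  have "cbox 0 1 \<inter> {x. axis i 1 \<bullet> x = 1} face_of (cbox 0 1 :: (real^'n) set)" for i
    by (rule face_of_Int_supporting_hyperplane_le) (simp_all add: inner_axis' mem_unit_cube)
  moreover have "cbox 0 1 \<inter> {x. axis i 1 \<bullet> x = 0} face_of (cbox 0 1 :: (real^'n) set)" for i
    by (rule face_of_Int_supporting_hyperplane_ge) (simp_all add: inner_axis' mem_unit_cube)
  moreover have "cube_face I J = \<Inter> (insert (cbox 0 1)
      ((\<lambda>i. cbox 0 1 \<inter> {x. axis i 1 \<bullet> x = 1}) ` I \<union> (\<lambda>i. cbox 0 1 \<inter> {x. axis i 1 \<bullet> x = 0}) ` J))"
    by (auto simp: cube_face_def inner_axis')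
  ultimately show ?thesis
    using face_of_refl[OF convex_box(1), of 0 1] by (simp only:) (rule face_of_Inter, blast, blast)
qed

lemma convex_cube_face: "convex (cube_face I J :: (real^'n::finite) set)"
  by (rule face_of_imp_convex[OF cube_face_face_of])

lemma closed_cube_face: "closed (cube_face I J :: (real^'n::finite) set)"
  by (rule compact_imp_closed[OF face_of_imp_compact[OF _ _ cube_face_face_of]]) simp_all

text \<open>
  A relative interior point \<open>x\<close> of \<open>F\<close> determines \<open>F\<close>: let \<open>I\<close> and \<open>J\<close> be the coordinates at
  which \<open>x\<close> is 1 and 0. Then \<open>x\<close> is a relative interior point of \<open>cube_face I J\<close> too, and two
  faces with a common relative interior point contain each other.
\<close>

lemma face_of_cubeE:
  fixes F :: "(real^'n::finite) set"
  assumes F: "F face_of cbox 0 1" and "F \<noteq> {}"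
  obtains I J where "I \<inter> J = {}" "F = cube_face I J"
proof -
  obtain x where x: "x \<in> rel_interior F"
    using assms face_of_imp_convex rel_interior_eq_empty by blast
  then have xF: "x \<in> F" using rel_interior_subset by blast
  then have cube: "x \<in> cbox 0 1" using F face_of_imp_subset by blast
  define I J where "I = {i. x $ i = 1}" and "J = {i. x $ i = 0}"
  have disj: "I \<inter> J = {}" by (auto simp: I_def J_def)
  have mem: "x \<in> cube_face I J" using cube by (auto simp: cube_face_def I_def J_def)
  have "x \<in> free_box (I \<union> J)"
    using cube by (auto simp: mem_unit_cube mem_free_box I_def J_def order_less_le)
  then have "x \<in> rel_interior (cube_face I J)"
    unfolding mem_rel_interior affine_hull_cube_face[OF disj]
    using mem open_free_box cube_flat_Int_free_box by blast
  then have "cube_face I J \<subseteq> F"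
    using xF by (intro subset_of_face_of[OF F]) (auto simp: cube_face_def)
  moreover have "F \<subseteq> cube_face I J"
    using x mem by (intro subset_of_face_of[OF cube_face_face_of face_of_imp_subset[OF F]]) auto
  ultimately show ?thesis using that disj by blast
qed

lemma intersects_cube_faces_iff:
  fixes P :: "(real^'n::finite) set"
  assumes "k \<le> CARD('n)"
  shows "(\<forall>F. F face_of (cbox 0 1 :: (real^'n) set) \<and> aff_dim F = int (CARD('n) - k) \<longrightarrow> P \<inter> F \<noteq> {})
    \<longleftrightarrow> (\<forall>I J. I \<inter> J = {} \<and> card I + card J = k \<longrightarrow> P \<inter> cube_face I J \<noteq> {})" (is "?L \<longleftrightarrow> ?R")
proof
  assume ?L
  show ?R
  proof (intro allI impI, elim conjE)
    fix I J :: "'n set" assume IJ: "I \<inter> J = {}" "card I + card J = k"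
    then have "aff_dim (cube_face I J) = int (CARD('n) - k)"
      by (simp add: aff_dim_cube_face card_Un_disjoint)
    then show "P \<inter> cube_face I J \<noteq> {}" using \<open>?L\<close> cube_face_face_of by blast
  qed
next
  assume R: ?R
  show ?L
  proof (intro allI impI, elim conjE)
    fix F :: "(real^'n) set"
    assume F: "F face_of cbox 0 1" and dim: "aff_dim F = int (CARD('n) - k)"
    then have "F \<noteq> {}" by auto
    then obtain I J where IJ: "I \<inter> J = {}" "F = cube_face I J" using F by (metis face_of_cubeE)
    then have "CARD('n) - card (I \<union> J) = CARD('n) - k"
      using dim aff_dim_cube_face[OF IJ(1)] by simp
    then have "card (I \<union> J) = k" using assms card_mono[of UNIV "I \<union> J"] by simp
    then show "P \<inter> F \<noteq> {}" using R IJ by (simp add: card_Un_disjoint)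
  qed
qed

section \<open>Rounding points of Lovasz--Schrijver relaxations\<close>

lemma LS_subset_LS0: "LS P \<subseteq> LS0 P"
  by (auto simp: LS_def LS0_def)

lemma LS0_mono: "P \<subseteq> Q \<Longrightarrow> LS0 P \<subseteq> LS0 Q"
  unfolding LS0_def LS_matrix_def cone_K_def by blast

lemma LS_funpow_subset_LS0_funpow: "(LS ^^ k) P \<subseteq> (LS0 ^^ k) P"
proof (induction k)
  case (Suc k)
  then show ?case using LS0_mono[OF Suc] LS_subset_LS0 by fastforce
qed simp

text \<open>
  What one application of \<open>LS0\<close> yields for a single coordinate \<open>i\<close>. The points \<open>q\<close> and \<open>q'\<close>
  come from \<open>Y e\<^sub>i\<close> and \<open>Y (e\<^sub>0 - e\<^sub>i)\<close>, whose scaling factors are read off row 0 of \<open>Y\<close>; the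
  diagonal condition gives \<open>q\<^sub>i = 1\<close> and \<open>q'\<^sub>i = 0\<close>, up to these factors, which may be 0.
\<close>

lemma LS0_segment:
  assumes "x \<in> LS0 Q"
  obtains q q' where "q \<in> Q" "q' \<in> Q" "0 \<le> x $ i" "x $ i \<le> 1"
    "x = (x $ i) *\<^sub>R q + (1 - x $ i) *\<^sub>R q'"
    "x $ i * q $ i = x $ i" "(1 - x $ i) * q' $ i = 0"
proof -
  obtain Y where Y: "LS_matrix Q x Y" using assms by (auto simp: LS0_def)
  have e0: "Y *v unit_vec None = homog 1 x" and e0': "transpose Y *v unit_vec None = homog 1 x"
    and diag: "\<And>i. Y $ i $ i = homog 1 x $ i"
    using Y by (auto simp: LS_matrix_def vec_eq_iff)
  obtain l q where q: "Y *v unit_vec (Some i) = homog l (l *\<^sub>R q)" "l \<ge> 0" "q \<in> Q"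
    using Y unfolding LS_matrix_def cone_K_def by blast
  obtain l' q' where q': "Y *v (unit_vec None - unit_vec (Some i)) = homog l' (l' *\<^sub>R q')" "l' \<ge> 0" "q' \<in> Q"
    using Y unfolding LS_matrix_def cone_K_def by blast
  have col: "(Y *v unit_vec c) $ r = Y $ r $ c" for r c
    by (simp add: matrix_vector_mult_basis column_def)
  have "(transpose Y *v unit_vec None) $ Some i = Y $ None $ Some i"
    by (simp add: matrix_vector_mult_basis column_def transpose_def)
  then have l: "l = x $ i" using q(1) e0' col[of "Some i" None] by (simp add: homog_def)
  have sum: "homog l (l *\<^sub>R q) + homog l' (l' *\<^sub>R q') = homog 1 x"
    unfolding q(1)[symmetric] q'(1)[symmetric] e0[symmetric]
    by (simp add: matrix_vector_mult_diff_distrib)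
  then have "(homog l (l *\<^sub>R q) + homog l' (l' *\<^sub>R q')) $ None = homog 1 x $ None" by simp
  then have l': "l' = 1 - x $ i" using l by (simp add: homog_def)
  have comp: "l * q $ j + l' * q' $ j = x $ j" for j
    using arg_cong[OF sum, of "\<lambda>v. v $ Some j"] by (simp add: homog_def)
  have qi: "l * q $ i = x $ i"
    using q(1) col[of "Some i" "Some i"] diag[of "Some i"] by (simp add: homog_def)
  then have q'i: "l' * q' $ i = 0" using comp[of i] by simp
  show ?thesis
  proof (rule that[OF q(3) q'(3)])
    show "x = (x $ i) *\<^sub>R q + (1 - x $ i) *\<^sub>R q'"
      using comp by (simp add: vec_eq_iff l l')
  qed (use l l' q q' qi q'i in auto)
qed

lemma LS0_funpow_subset_cube: "P \<subseteq> cbox 0 1 \<Longrightarrow> (LS0 ^^ t) P \<subseteq> cbox 0 1"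
proof (induction t)
  case (Suc t)
  show ?case
  proof
    fix x assume "x \<in> (LS0 ^^ Suc t) P"
    then have "x \<in> LS0 ((LS0 ^^ t) P)" by simp
    then have "0 \<le> x $ i \<and> x $ i \<le> 1" for i using LS0_segment[of x "(LS0 ^^ t) P" i] by metis
    then show "x \<in> cbox 0 1" by (simp add: mem_unit_cube)
  qed
qed simp

text \<open>
  If a coordinate of \<open>x \<in> LS0 Q\<close> is 0 or 1, one of the two points of the segment decomposition
  equals \<open>x\<close>, so \<open>x \<in> Q\<close>. Hence \<open>LS0\<close> adds no integer points.
\<close>

lemma LS0_funpow_integer_empty: "integer_empty P \<Longrightarrow> integer_empty ((LS0 ^^ t) P)"
proof (induction t)
  case (Suc t)
  have "x \<in> (LS0 ^^ t) P" if x: "x \<in> (LS0 ^^ Suc t) P" and int: "\<forall>i. x $ i \<in> {0, 1}" for x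
  proof -
    \<comment> \<open>Any coordinate serves; \<open>undefined\<close> names one, as the index type is nonempty.\<close>
    have "x \<in> LS0 ((LS0 ^^ t) P)" using x by simp
    then obtain q q' where q: "q \<in> (LS0 ^^ t) P" "q' \<in> (LS0 ^^ t) P"
      and sum: "x = (x $ undefined) *\<^sub>R q + (1 - x $ undefined) *\<^sub>R q'"
      by (rule LS0_segment[where i = undefined])
    have "x $ undefined = 0 \<or> x $ undefined = 1" using int by blast
    then have "x = q' \<or> x = q"
    proof
      assume "x $ undefined = 0"
      with sum have "x = 0 *\<^sub>R q + (1 - 0) *\<^sub>R q'" by metis
      then show ?thesis by simp
    next
      assume "x $ undefined = 1"
      with sum have "x = 1 *\<^sub>R q + (1 - 1) *\<^sub>R q'" by metis
      then show ?thesis by simp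
    qed
    then show ?thesis using q by blast
  qed
  then show ?case using Suc unfolding integer_empty_def by blast
qed simp

text \<open>
  A point in \<open>LS0\<^sup>t P\<close> has a fractional coordinate \<open>e\<close>, which can be rounded to 0 or 1, whichever
  is desired, at the cost of one application of \<open>LS0\<close>. Coordinates rounded before keep
  their values, as \<open>x\<close> is an inner point of the segment between the two candidates and lies in
  a face of the cube. So one can choose freely how many coordinates become 1 and how many 0,
  but not which ones.
\<close>

lemma LS0_funpow_rounding:
  fixes P :: "(real^'n::finite) set"
  assumes P: "P \<subseteq> cbox 0 1" "integer_empty P"
    and "x \<in> (LS0 ^^ (i + j)) P" "x \<in> cube_face A B"
  shows "\<exists>I J. I \<inter> J = {} \<and> (I \<union> J) \<inter> (A \<union> B) = {} \<and> card I = i \<and> card J = j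
    \<and> P \<inter> cube_face (A \<union> I) (B \<union> J) \<noteq> {}"
  using assms(3,4)
proof (induction "i + j" arbitrary: i j x A B)
  case 0
  then show ?case by (intro exI[of _ "{}"]) auto
next
  case (Suc t)
  let ?Q = "(LS0 ^^ t) P"
  have x: "x \<in> LS0 ?Q" using Suc.prems Suc.hyps(2) by (metis comp_apply funpow.simps(2))
  have "x \<in> (LS0 ^^ Suc t) P" using x by simp
  then obtain e where e: "x $ e \<noteq> 0" "x $ e \<noteq> 1"
    using LS0_funpow_integer_empty[OF P(2), of "Suc t"] unfolding integer_empty_def by blast
  obtain q q' where q: "q \<in> ?Q" "q' \<in> ?Q" and xe: "0 \<le> x $ e" "x $ e \<le> 1"
    and sum: "x = (x $ e) *\<^sub>R q + (1 - x $ e) *\<^sub>R q'"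
    and "x $ e * q $ e = x $ e" "(1 - x $ e) * q' $ e = 0"
    using LS0_segment[OF x, of e] by blast
  then have qe: "q $ e = 1" "q' $ e = 0" using e by auto
  have cube: "q \<in> cbox 0 1" "q' \<in> cbox 0 1"
    using q LS0_funpow_subset_cube[OF P(1)] by blast+
  have "x \<in> open_segment q' q"
    unfolding in_segment using sum qe xe e by (auto intro!: exI[of _ "x $ e"] simp: add.commute)
  then have "q \<in> cube_face A B" "q' \<in> cube_face A B"
    using cube_face_face_of[of A B] cube Suc.prems(2) unfolding face_of_def by blast+
  then have q1: "q \<in> cube_face (insert e A) B" and q0: "q' \<in> cube_face A (insert e B)"
    using qe by (auto simp: cube_face_def)
  have eAB: "e \<notin> A \<union> B" using e Suc.prems(2) by (auto simp: cube_face_def)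
  show ?case
  proof (cases i)
    case (Suc i')
    then obtain I J where *: "I \<inter> J = {}" "(I \<union> J) \<inter> (insert e A \<union> B) = {}" "card I = i'" "card J = j"
      "P \<inter> cube_face (insert e A \<union> I) (B \<union> J) \<noteq> {}"
      using Suc.hyps(1)[of i' j q "insert e A" B] Suc.hyps(2) q q1 by auto
    then show ?thesis using Suc eAB by (intro exI[of _ "insert e I"] exI[of _ J]) auto
  next
    case 0
    then obtain j' where j': "j = Suc j'" using Suc.hyps(2) by (cases j) auto
    then obtain I J where *: "I \<inter> J = {}" "(I \<union> J) \<inter> (A \<union> insert e B) = {}" "card I = i" "card J = j'"
      "P \<inter> cube_face (A \<union> I) (insert e B \<union> J) \<noteq> {}"
      using Suc.hyps(1)[of i j' q' A "insert e B"] Suc.hyps(2) q q0 by auto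
    then show ?thesis using j' eAB by (intro exI[of _ I] exI[of _ "insert e J"]) auto
  qed
qed

section \<open>Symmetries and least-norm points\<close>

lemma norm_perm_act: "bij \<pi> \<Longrightarrow> norm (perm_act \<pi> x) = norm (x :: real^'n::finite)"
  unfolding norm_vec_def L2_set_def perm_act_def
  using sum.reindex_bij_betw[OF bij_imp_bij_inv, of \<pi> "\<lambda>i. (norm (x $ i))\<^sup>2"] by simp

lemma perm_act_mem_cube_face:
  assumes "bij \<pi>" "x \<in> cube_face I J"
  shows "perm_act \<pi> x \<in> cube_face (\<pi> ` I) (\<pi> ` J)"
  using assms by (auto simp: cube_face_def mem_unit_cube perm_act_def bij_is_inj)

text \<open>
  Enumerate \<open>I\<close>, \<open>J\<close> and \<open>u\<close> in one list. The extra element \<open>u\<close> is what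
  \<open>(k + 1)\<close>-transitivity provides beyond \<open>k\<close>-transitivity.
\<close>

lemma transitive_perms_moves_face:
  fixes G :: "('n::finite \<Rightarrow> 'n) set"
  assumes G: "transitive_perms (card I + card J + 1) G"
    and IJ: "I \<inter> J = {}" "u \<notin> I \<union> J" and IJ': "I' \<inter> J' = {}" "u' \<notin> I' \<union> J'"
    and card: "card I' = card I" "card J' = card J"
  obtains \<pi> where "\<pi> \<in> G" "\<pi> ` I = I'" "\<pi> ` J = J'" "\<pi> u = u'"
proof -
  obtain s t where st: "set s = I" "distinct s" "set t = J" "distinct t"
    using finite_distinct_list[of I] finite_distinct_list[of J] by auto
  obtain s' t' where st': "set s' = I'" "distinct s'" "set t' = J'" "distinct t'"
    using finite_distinct_list[of I'] finite_distinct_list[of J'] by auto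
  have len: "length s = card I" "length t = card J" "length s' = card I" "length t' = card J"
    using st st' card by (auto simp flip: distinct_card)
  have "\<exists>\<pi>\<in>G. map \<pi> (s @ t @ [u]) = s' @ t' @ [u']"
    by (rule G[unfolded transitive_perms_def, rule_format]) (use IJ IJ' st st' len in simp)
  then obtain \<pi> where "\<pi> \<in> G" and "map \<pi> s = s'" "map \<pi> t = t'" "\<pi> u = u'"
    using len by auto
  moreover have "\<pi> ` I = I'" "\<pi> ` J = J'"
    using \<open>map \<pi> s = s'\<close> \<open>map \<pi> t = t'\<close> st st' by (metis set_map)+
  ultimately show ?thesis using that by blast
qed

text \<open>
  Permuting coordinates preserves the norm, so by uniqueness a permutation in \<open>G\<close> that maps one
  face to another maps the point of \<open>P\<close> of least norm in the first to that in the second. For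
  \<open>I' = I\<close> and \<open>J' = J\<close> this says that the least-norm point is constant outside \<open>I \<union> J\<close>.
\<close>

lemma closest_point_cube_face_cong:
  fixes P :: "(real^'n::finite) set"
  assumes P: "convex P" "closed P" and inv: "invariant_under G P"
    and G: "transitive_perms (card I + card J + 1) G"
    and IJ: "I \<inter> J = {}" "u \<notin> I \<union> J" and IJ': "I' \<inter> J' = {}" "u' \<notin> I' \<union> J'"
    and card: "card I' = card I" "card J' = card J"
    and ne: "P \<inter> cube_face I J \<noteq> {}"
  shows "closest_point (P \<inter> cube_face I' J') 0 $ u' = closest_point (P \<inter> cube_face I J) 0 $ u"
proof -
  have G_sym: "bij \<rho>" "x \<in> P \<Longrightarrow> perm_act \<rho> x \<in> P" if "\<rho> \<in> G" for \<rho> x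
    using inv that by (auto simp: invariant_under_def sym_of_def permutes_bij)
  have face: "convex (P \<inter> cube_face A B)" "closed (P \<inter> cube_face A B)" for A B
    using P by (simp_all add: convex_Int closed_Int convex_cube_face closed_cube_face)
  obtain \<pi> where \<pi>: "\<pi> \<in> G" "\<pi> ` I = I'" "\<pi> ` J = J'" "\<pi> u = u'"
    using transitive_perms_moves_face[OF G IJ IJ' card] .
  obtain \<sigma> where \<sigma>: "\<sigma> \<in> G" "\<sigma> ` I' = I" "\<sigma> ` J' = J"
    using transitive_perms_moves_face[of I' J' G u' I J u] G IJ IJ' card by metis
  let ?p = "closest_point (P \<inter> cube_face I J) 0" and ?p' = "closest_point (P \<inter> cube_face I' J') 0"
  have p: "?p \<in> P \<inter> cube_face I J" using closest_point_in_set[OF face(2) ne] .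
  then have \<pi>p: "perm_act \<pi> ?p \<in> P \<inter> cube_face I' J'"
    using G_sym[OF \<pi>(1)] perm_act_mem_cube_face[of \<pi> ?p I J] \<pi> by auto
  then have p': "?p' \<in> P \<inter> cube_face I' J'" by (intro closest_point_in_set face) auto
  then have \<sigma>p: "perm_act \<sigma> ?p' \<in> P \<inter> cube_face I J"
    using G_sym[OF \<sigma>(1)] perm_act_mem_cube_face[of \<sigma> ?p' I' J'] \<sigma> by auto
  \<comment> \<open>Moving back with \<open>\<sigma>\<close> shows that \<open>\<pi>\<close> maps the minimizer to a point of minimal norm.\<close>
  have "norm ?p \<le> norm ?p'"
    using closest_point_le[OF face(2) \<sigma>p, of 0] norm_perm_act[OF G_sym(1)[OF \<sigma>(1)], of ?p'] by simp
  then have "norm (perm_act \<pi> ?p) \<le> norm z" if "z \<in> P \<inter> cube_face I' J'" for z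
    using closest_point_le[OF face(2) that, of 0] norm_perm_act[OF G_sym(1)[OF \<pi>(1)], of ?p] by simp
  then have "perm_act \<pi> ?p = ?p'"
    by (intro closest_point_unique face \<pi>p) simp
  moreover have "inv_into UNIV \<pi> u' = u"
    using G_sym(1)[OF \<pi>(1)] \<pi>(4) by (metis bij_inv_eq_iff)
  ultimately show ?thesis by (metis perm_act_def vec_lambda_beta)
qed

definition level_point :: "real \<Rightarrow> 'n set \<Rightarrow> 'n set \<Rightarrow> real^'n" where
  "level_point c I J = (\<chi> j. if j \<in> I then 1 else if j \<in> J then 0 else c)"

text \<open>
  The least-norm points of the faces with \<open>card I = i\<close> all have the same free value \<open>c\<close>. It is
  neither 0 nor 1, as \<open>P\<close> has no integer points.
\<close>

lemma ex_level_point: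
  fixes P :: "(real^'n::finite) set"
  assumes "i \<le> k" "k < CARD('n)"
    and P: "convex P" "closed P" "P \<subseteq> cbox 0 1" "integer_empty P" "transitive_polytope (k + 1) P"
    and meets: "\<And>I J. I \<inter> J = {} \<Longrightarrow> card I + card J = k \<Longrightarrow> P \<inter> cube_face I J \<noteq> {}"
  shows "\<exists>c. 0 < c \<and> c < 1 \<and>
    (\<forall>I J. I \<inter> J = {} \<and> card I = i \<and> card J = k - i \<longrightarrow> level_point c I J \<in> P)"
proof -
  obtain G where G: "invariant_under G P" "transitive_perms (k + 1) G"
    using P(5) unfolding transitive_polytope_def by auto
  obtain I0 :: "'n set" where I0: "card I0 = i"
    using obtain_subset_with_card_n[of i "UNIV :: 'n set"] assms by auto
  then have "k - i \<le> card (- I0)" using assms by (simp add: Compl_eq_Diff_UNIV card_Diff_subset)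
  then obtain J0 where J0: "J0 \<subseteq> - I0" "card J0 = k - i"
    using obtain_subset_with_card_n by metis
  then have card0: "card I0 + card J0 = k" and disj0: "I0 \<inter> J0 = {}" using I0 assms by auto
  then have "I0 \<union> J0 \<noteq> UNIV" using assms card_Un_disjoint[of I0 J0] by auto
  then obtain u0 where u0: "u0 \<notin> I0 \<union> J0" by blast
  define c where "c = closest_point (P \<inter> cube_face I0 J0) 0 $ u0"
  have mem: "level_point c I J \<in> P" if IJ: "I \<inter> J = {}" "card I = i" "card J = k - i" for I J
  proof -
    let ?p = "closest_point (P \<inter> cube_face I J) 0"
    have "closed (P \<inter> cube_face I J)"
      using P by (simp add: closed_Int closed_cube_face)
    then have p: "?p \<in> P \<inter> cube_face I J"
      using meets[of I J] IJ assms(1) by (intro closest_point_in_set) auto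
    have "?p $ u = c" if "u \<notin> I \<union> J" for u
      unfolding c_def
      using closest_point_cube_face_cong[OF P(1,2) G(1) _ disj0 u0 IJ(1) that _ _ meets[OF disj0 card0]]
        G(2) card0 I0 J0 IJ by simp
    then have "?p = level_point c I J"
      using p by (auto simp: vec_eq_iff level_point_def cube_face_def)
    then show ?thesis using p by auto
  qed
  then have p0: "level_point c I0 J0 \<in> P" using I0 J0 disj0 by blast
  have "c \<notin> {0, 1}"
  proof
    assume "c \<in> {0, 1}"
    then have "\<forall>j. level_point c I0 J0 $ j \<in> {0, 1}" by (simp add: level_point_def)
    then show False using p0 P(4) by (auto simp: integer_empty_def)
  qed
  moreover have "level_point c I0 J0 $ u0 = c" using u0 by (simp add: level_point_def)
  then have "0 \<le> c" "c \<le> 1" using p0 P(3) mem_unit_cube by (metis subsetD)+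
  ultimately show ?thesis using mem by (intro exI[of _ c]) auto
qed

section \<open>Symmetric points of the Sherali--Adams lift\<close>

text \<open>
  If every 0/1 vector with \<open>l\<close> ones has weight \<open>v l\<close>, then \<open>free_weight v r i\<close> is the total
  weight of the vectors in which \<open>r\<close> entries are free and the others are prescribed, with
  \<open>i\<close> of the prescribed values equal to 1.
\<close>

fun free_weight :: "(nat \<Rightarrow> real) \<Rightarrow> nat \<Rightarrow> nat \<Rightarrow> real" where
  "free_weight v 0 i = v i"
| "free_weight v (Suc r) i = free_weight v r i + free_weight v r (Suc i)"

lemma free_weight_pos: "(\<And>l. l \<le> i + r \<Longrightarrow> v l > 0) \<Longrightarrow> free_weight v r i > 0"
  by (induction r arbitrary: i) (simp_all add: add_pos_pos)

text \<open>
  The pseudo-probabilities of a symmetric \<open>y\<close>. Both sides satisfy the same recursion in \<open>J\<close>: the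
  defining equation of \<open>free_weight\<close> splits a free entry into the cases 0 and 1.
\<close>

lemma pseudo_prob_free_weight:
  fixes y :: "'n::finite set \<Rightarrow> real"
  assumes y: "\<And>I. card I \<le> s \<Longrightarrow> y I = free_weight v (s - card I) (card I) / N"
    and "I \<inter> J = {}" "card I + card J \<le> s"
  shows "pseudo_prob y I J = free_weight v (s - card I - card J) (card I) / N"
proof -
  have "finite J" by simp
  then show ?thesis
    using assms(2,3)
  proof (induction J arbitrary: I)
    case empty
    then show ?case by (simp add: pseudo_prob_empty y)
  next
    case (insert j J)
    define r where "r = s - card I - card (insert j J)"
    have r: "s - card I - card J = Suc r" "s - card (insert j I) - card J = r"
      using insert by (auto simp: r_def)
    have "pseudo_prob y I (insert j J) = pseudo_prob y I J - pseudo_prob y (insert j I) J"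
      using insert by (intro pseudo_prob_insert_right)
    also have "\<dots> = free_weight v (Suc r) (card I) / N - free_weight v r (card (insert j I)) / N"
      using insert.IH[of I] insert.IH[of "insert j I"] insert.prems insert.hyps r by simp
    also have "\<dots> = free_weight v r (card I) / N"
      using insert by (simp add: add_divide_distrib)
    finally show ?case by (simp add: r_def)
  qed
qed

text \<open>
  A lift \<open>y\<close> depending only on \<open>card I\<close> is determined by the weights \<open>v i\<close> of the events that
  fix \<open>k + 1\<close> coordinates, \<open>i\<close> of them to 1. Given an event fixing \<open>k\<close> coordinates, \<open>i\<close> of
  them to 1, each free coordinate is 1 with conditional probability
  \<open>v (i + 1) / (v i + v (i + 1))\<close>. This is \<open>\<alpha> i\<close> exactly if
  \<open>v (i + 1) = \<alpha> i / (1 - \<alpha> i) v i\<close>; then the conditional expectation is a level point,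
  lies in \<open>P\<close>, and the Sherali--Adams inequalities follow.
\<close>

lemma SA_nonempty_of_level_points:
  fixes a :: "nat \<Rightarrow> real^'n"
  assumes P: "box_description m a b P"
    and \<alpha>: "\<And>i. i \<le> k \<Longrightarrow> 0 < \<alpha> i \<and> \<alpha> i < 1"
    and mem: "\<And>I J. I \<inter> J = {} \<Longrightarrow> card I + card J = k \<Longrightarrow> level_point (\<alpha> (card I)) I J \<in> P"
  shows "SA k m a b \<noteq> {}"
proof -
  define v where "v i = (\<Prod>l<i. \<alpha> l / (1 - \<alpha> l))" for i
  define N where "N = free_weight v (k + 1) 0"
  define y where "y = (\<lambda>I\<in>{I :: 'n set. card I \<le> k + 1}. free_weight v (k + 1 - card I) (card I) / N)"
  have v_pos: "v i > 0" if "i \<le> k + 1" for i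
    unfolding v_def using \<alpha> that by (intro prod_pos) auto
  have v_Suc: "\<alpha> i * (v i + v (Suc i)) = v (Suc i)" if "i \<le> k" for i
  proof -
    have "1 - \<alpha> i \<noteq> 0" using \<alpha>[OF that] by simp
    then show ?thesis by (simp add: v_def field_simps)
  qed
  have N: "N > 0" unfolding N_def using v_pos by (intro free_weight_pos) simp
  have pseudo_prob: "pseudo_prob y I J = free_weight v (k + 1 - card I - card J) (card I) / N"
    if "I \<inter> J = {}" "card I + card J \<le> k + 1" for I J
    using that by (intro pseudo_prob_free_weight) (simp_all add: y_def)
  have ineq: "linearize y (SA_poly (a i) (b i) J I) \<ge> 0"
    if i: "i \<in> {1..m}" and IJ: "I \<inter> J = {}" "card I + card J = k" for i I J
  proof -
    define w where "w = (v (card I) + v (Suc (card I))) / N"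
    let ?p = "level_point (\<alpha> (card I)) I J"
    have w: "pseudo_prob y I J = w" using IJ by (simp add: pseudo_prob w_def)
    have "pseudo_prob y (insert j I) J = w * ?p $ j" for j
    proof -
      consider "j \<in> I" | "j \<in> J" "j \<notin> I" | "j \<notin> I \<union> J" by blast
      then show ?thesis
      proof cases
        case 1
        then show ?thesis using w by (simp add: insert_absorb level_point_def)
      next
        case 2
        then have "pseudo_prob y (insert j I) J = 0" by (intro pseudo_prob_overlap) auto
        then show ?thesis using 2 by (simp add: level_point_def)
      next
        case 3
        then have "pseudo_prob y (insert j I) J = v (Suc (card I)) / N"
          using IJ by (subst pseudo_prob) auto
        also have "\<dots> = w * \<alpha> (card I)"
          using v_Suc[of "card I"] IJ by (simp add: w_def mult.commute)
        finally show ?thesis using 3 by (simp add: level_point_def)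
      qed
    qed
    then have "linearize y (SA_poly (a i) (b i) J I) = (\<Sum>j\<in>UNIV. a i $ j * (w * ?p $ j)) - b i * w"
      by (simp add: linearize_SA_poly w)
    also have "\<dots> = w * (a i \<bullet> ?p - b i)"
      by (simp add: inner_vec_def sum_distrib_left algebra_simps)
    also have "\<dots> \<ge> 0"
    proof (rule mult_nonneg_nonneg)
      show "0 \<le> w" using v_pos[of "card I"] v_pos[of "Suc (card I)"] N IJ by (simp add: w_def)
      show "0 \<le> a i \<bullet> ?p - b i" using mem[OF IJ] P i by (simp add: box_description_def)
    qed
    finally show ?thesis .
  qed
  have "linearize y (SA_poly (a i) (b i) J0 J1) \<ge> 0"
    if "i \<in> {1..m}" "card S = k" "J0 \<union> J1 = S" "J0 \<inter> J1 = {}" for i S J0 J1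
    using ineq[of i J1 J0] that card_Un_disjoint[of J0 J1] by (auto simp: Int_commute)
  moreover have "y {} = 1" using N by (simp add: y_def N_def)
  moreover have "y \<in> {I. card I \<le> k + 1} \<rightarrow>\<^sub>E UNIV" by (simp add: y_def)
  ultimately have "y \<in> SA_lift k m a b" unfolding SA_lift_def by blast
  then have "(\<chi> i. y {i}) \<in> SA k m a b" unfolding SA_def by auto
  then show ?thesis by blast
qed

section \<open>Equivalence of the four statements\<close>

theorem theorem1p1:
  fixes P :: "(real^'n) set" and k m :: nat
    and a :: "nat \<Rightarrow> real^'n" and b :: "nat \<Rightarrow> real"
  assumes "k < CARD('n)"
    and "polytope P" and "P \<subseteq> cbox 0 1"
    and "transitive_polytope (k + 1) P"
    and "integer_empty P"
    and "box_description m a b P"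
  shows "((\<forall>F. F face_of (cbox 0 1 :: (real^'n) set) \<and> aff_dim F = int (CARD('n) - k)
              \<longrightarrow> P \<inter> F \<noteq> {})
            \<longleftrightarrow> SA k m a b \<noteq> {})
       \<and> (SA k m a b \<noteq> {} \<longleftrightarrow> (LS ^^ k) P \<noteq> {})
       \<and> ((LS ^^ k) P \<noteq> {} \<longleftrightarrow> (LS0 ^^ k) P \<noteq> {})"
proof -
  let ?A = "\<forall>I J. I \<inter> J = {} \<and> card I + card J = k \<longrightarrow> P \<inter> cube_face I J \<noteq> {}"
  have AB: "SA k m a b \<noteq> {}" if A: ?A
  proof -
    define good where "good i c \<longleftrightarrow> 0 < c \<and> c < 1 \<and>
      (\<forall>I J. I \<inter> J = {} \<and> card I = i \<and> card J = k - i \<longrightarrow> level_point c I J \<in> P)" for i c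
    have "\<exists>c. good i c" if "i \<le> k" for i
      unfolding good_def using assms A that
      by (intro ex_level_point) (auto simp: polytope_imp_convex polytope_imp_closed)
    then obtain \<alpha> where \<alpha>: "\<And>i. i \<le> k \<Longrightarrow> good i (\<alpha> i)" by metis
    show ?thesis
      by (rule SA_nonempty_of_level_points[OF assms(6), of k \<alpha>]) (use \<alpha> in \<open>force simp: good_def\<close>)+
  qed
  have BC: "SA k m a b \<subseteq> (LS ^^ k) P" using SA_subset_LS_funpow assms by blast
  have CD: "(LS ^^ k) P \<subseteq> (LS0 ^^ k) P" by (rule LS_funpow_subset_LS0_funpow)
  have DA: ?A if "(LS0 ^^ k) P \<noteq> {}"
  proof (intro allI impI, elim conjE)
    fix I J :: "'n set" assume IJ: "I \<inter> J = {}" "card I + card J = k"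
    have "(LS0 ^^ (card I + card J)) P \<noteq> {}" using that by (simp add: IJ(2))
    then obtain x where x: "x \<in> (LS0 ^^ (card I + card J)) P" by blast
    then have "x \<in> cube_face {} {}"
      using LS0_funpow_subset_cube[OF assms(3)] by (auto simp: cube_face_def)
    then obtain I' J' where IJ': "I' \<inter> J' = {}" "card I' = card I" "card J' = card J"
      and ne: "P \<inter> cube_face I' J' \<noteq> {}"
      using LS0_funpow_rounding[OF assms(3,5) x, of "{}" "{}"] unfolding Un_empty_left by blast
    have "I \<union> J \<noteq> UNIV" "I' \<union> J' \<noteq> UNIV"
      using IJ IJ' assms(1) card_Un_disjoint[of I J] card_Un_disjoint[of I' J'] by auto
    then obtain u u' where u: "u \<notin> I \<union> J" "u' \<notin> I' \<union> J'" by blast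
    obtain G where G: "invariant_under G P" "transitive_perms (card I' + card J' + 1) G"
      using assms(4) IJ IJ' unfolding transitive_polytope_def by auto
    obtain \<pi> where \<pi>: "\<pi> \<in> G" "\<pi> ` I' = I" "\<pi> ` J' = J"
      using transitive_perms_moves_face[OF G(2) IJ'(1) u(2) IJ(1) u(1)] IJ' by metis
    obtain p where "p \<in> P" "p \<in> cube_face I' J'" using ne by blast
    then have "perm_act \<pi> p \<in> P \<inter> cube_face I J"
      using perm_act_mem_cube_face[of \<pi> p I' J'] \<pi> G(1)
      by (auto simp: invariant_under_def sym_of_def permutes_bij)
    then show "P \<inter> cube_face I J \<noteq> {}" by blast
  qed
  show ?thesis
    unfolding intersects_cube_faces_iff[OF less_imp_le[OF assms(1)]]
    using AB BC CD DA by blast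
qed

end
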